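(* Let $L=\mathcal{L}\bigl((\mathtt{a}\mathtt{b})^*(\mathtt{a}\vee\varepsilon)\bigr)=\{(\mathtt{ab})^{\frac{1}{2}i}\mid i\ge0\}$. Then $L\in\mathcal{L}(\mathsf{REG})\setminus\mathcal{L}(\mathsf{DRX})$; that is, $L$ is regular but there is no deterministic regex $\alpha$ with $\mathcal{L}(\alpha)=L$.
   Context: For a word $w=a_1\cdots a_n$, $w^{m+\frac{i}{n}}=w^m a_1\cdots a_i$ for $m\ge0$, $0\le i\le n$. Regex. Let $\Sigma$ be a finite terminal alphabet ($|\Sigma|\ge 2$ unless otherwise noted) and $\Xi$ an infinite variable alphabet disjoint from $\Sigma$. The set $\mathsf{RX}$ of regex, with $\mathsf{var}(\alpha)\subset\Xi$ the set of variables occurring in $\alpha$, is defined recursively: every $a\in\Sigma\cup\{\varepsilon\}$ is a regex; $\&x$ (variable reference) for $x\in\Xi$; $(\alpha\cdot\beta)$, $(\alpha\vee\beta)$, $(\alpha^+)$ for $\alpha,\beta\in\mathsf{RX}$; and $\langle x:\alpha\rangle$ (variable binding) for $\alpha\in\mathsf{RX}$ and $x\in\Xi\setminus\mathsf{var}(\alpha)$. Also $\emptyset$ is a regex, but may not occur inside another regex. $\alpha^*$ abbreviates $\varepsilon\vee\alpha^+$; a nonempty set $A\subseteq\Sigma$ abbreviates $\bigvee_{a\in A}a$. $\mathsf{REG}$ is the set of regex with $\mathsf{var}(\alpha)=\emptyset$ (the usual regular expressions). Let $\Gamma=\{[_x,]_x\mid x\in\Xi\}$. The ref-language $\mathcal{R}(\alpha)\subseteq(\Sigma\cup\Xi\cup\Gamma)^*$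 is given by $\mathcal{R}(\emptyset)=\emptyset$, $\mathcal{R}(a)=\{a\}$ for $a\in\Sigma\cup\{\varepsilon\}$, $\mathcal{R}(\&x)=\{x\}$, $\mathcal{R}(\langle x:\alpha\rangle)=[_x\mathcal{R}(\alpha)]_x$, $\mathcal{R}(\alpha\cdot\beta)=\mathcal{R}(\alpha)\mathcal{R}(\beta)$, $\mathcal{R}(\alpha\vee\beta)=\mathcal{R}(\alpha)\cup\mathcal{R}(\beta)$, $\mathcal{R}(\alpha^+)=\mathcal{R}(\alpha)^+$. For $r\in\mathcal{R}(\alpha)$, the dereference $\mathcal{D}(r)\in\Sigma^*$ is obtained by replacing each occurrence of a variable $x$ by $v$, where $[_x v]_x$ is the nearest such factor to the left of this occurrence (or by $\varepsilon$ if there is none; variables inside $v$ are replaced likewise), and then deleting all symbols of $\Gamma$. $\mathcal{L}(\alpha)=\{\mathcal{D}(r)\mid r\in\mathcal{R}(\alpha)\}$. Deterministic regex. Let $\alpha_{\mathcal{R}}$ be the regular expression over $\Sigma\cup\Xi\cup\Gamma$ obtained from $\alpha$ by replacing each $\langle x:\beta\rangle$ by $[_x\beta_{\mathcal{R}}]_x$ and each $\&x$ by $x$. The marked regex $\tilde\alpha$ is obtained from $\alpha_{\mathcal{R}}$ by attaching to each occurrence of a symbol $\chi\in\Sigma\cup\Xi\cup\Gamma$ its own unique number $i$, written $\chi_{(i)}$; $\mathcal{R}(\tilde\alpha)$ is the language of marked ref-words it generates. $\tilde A$ denotes the set of marked symbols from $A$. A regex $\alpha$ is not deterministic if there exist $\rho_1,\rho_2\in\mathcal{R}(\tilde\alpha)$,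 $r,s_1,s_2\in(\tilde\Sigma\cup\tilde\Xi\cup\tilde\Gamma)^*$ and $\gamma_1,\gamma_2\in\tilde\Gamma^*$ such that one of the following holds: (1) $\rho_1=r\gamma_1a_{(i)}s_1$ and $\rho_2=r\gamma_2a_{(j)}s_2$ with $a\in\Sigma$, $i\ne j$; (2) $\rho_1=r\gamma_1x_{(i)}s_1$ and $\rho_2=r\gamma_2\chi_{(j)}s_2$ with $x\in\Xi$, $\chi\in\Sigma\cup\Xi$, $i\neq j$; (3) $\rho_1=r\gamma_1\chi_{(i)}s_1$ and $\rho_2=r\gamma_2\chi_{(i)}s_2$ with $\chi\in\Sigma\cup\Xi$, $\gamma_1\ne\gamma_2$; (4) $\rho_1=r\gamma_1$ and $\rho_2=r\gamma_2$ with $\gamma_1\neq\gamma_2$. Otherwise $\alpha$ is deterministic. $\mathsf{DRX}$ is the set of deterministic regex. $\mathcal{L}(\mathcal{C})=\{\mathcal{L}(C)\mid C\in\mathcal{C}\}$ for a class $\mathcal{C}$ of expressions. *)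

theory Defs
  imports Complex_Main
begin

datatype ('a, var: 'v) regex =
    EmptySet
  | Eps
  | Sym 'a
  | Ref 'v
  | Cat "('a, 'v) regex" "('a, 'v) regex"
  | Alt "('a, 'v) regex" "('a, 'v) regex"
  | Iter "('a, 'v) regex"  \<comment> \<open>one or more repetitions\<close>
  | Bind 'v "('a, 'v) regex"

abbreviation Star :: "('a, 'v) regex \<Rightarrow> ('a, 'v) regex" where
  "Star \<alpha> \<equiv> Alt Eps (Iter \<alpha>)"

text \<open>The datatype is more liberal than the syntax of regex: \<open>EmptySet\<close> may not occur inside
  another regex, and in \<open>Bind x \<alpha>\<close> the variable \<open>x\<close> may neither be referenced nor bound in \<open>\<alpha>\<close>
  (the set function \<open>var\<close> collects both kinds of occurrence).\<close>

primrec proper :: "('a, 'v) regex \<Rightarrow> bool" where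
  "proper EmptySet \<longleftrightarrow> False"
| "proper Eps \<longleftrightarrow> True"
| "proper (Sym a) \<longleftrightarrow> True"
| "proper (Ref x) \<longleftrightarrow> True"
| "proper (Cat \<alpha> \<beta>) \<longleftrightarrow> proper \<alpha> \<and> proper \<beta>"
| "proper (Alt \<alpha> \<beta>) \<longleftrightarrow> proper \<alpha> \<and> proper \<beta>"
| "proper (Iter \<alpha>) \<longleftrightarrow> proper \<alpha>"
| "proper (Bind x \<alpha>) \<longleftrightarrow> proper \<alpha> \<and> x \<notin> var \<alpha>"

definition RX :: "('a, 'v) regex set" where
  "RX = insert EmptySet {\<alpha>. proper \<alpha>}"

definition REG :: "('a, 'v) regex set" where
  "REG = {\<alpha> \<in> RX. var \<alpha> = {}}"

datatype ('a, 'v) rsym = Term 'a | Var 'v | Open 'v | Close 'v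

type_synonym ('a, 'v) refword = "('a, 'v) rsym list"

definition conc :: "'c list set \<Rightarrow> 'c list set \<Rightarrow> 'c list set" where
  "conc A B = {u @ v | u v. u \<in> A \<and> v \<in> B}"

definition iter :: "'c list set \<Rightarrow> 'c list set" where
  "iter A = {concat ws | ws. ws \<noteq> [] \<and> set ws \<subseteq> A}"

primrec ref_lang :: "('a, 'v) regex \<Rightarrow> ('a, 'v) refword set" where
  "ref_lang EmptySet = {}"
| "ref_lang Eps = {[]}"
| "ref_lang (Sym a) = {[Term a]}"
| "ref_lang (Ref x) = {[Var x]}"
| "ref_lang (Cat \<alpha> \<beta>) = conc (ref_lang \<alpha>) (ref_lang \<beta>)"
| "ref_lang (Alt \<alpha> \<beta>) = ref_lang \<alpha> \<union> ref_lang \<beta>"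
| "ref_lang (Iter \<alpha>) = iter (ref_lang \<alpha>)"
| "ref_lang (Bind x \<alpha>) = conc {[Open x]} (conc (ref_lang \<alpha>) {[Close x]})"

text \<open>\<open>nearest_factor x p q v\<close>: in the word \<open>p\<close>, the factor \<open>[_x v ]_x\<close> that starts right after
  the prefix \<open>q\<close> is the rightmost one. Since brackets for the same variable are never nested in a
  ref-word of a regex, \<open>v\<close> contains no brackets for \<open>x\<close>.\<close>

definition nearest_factor ::
  "'v \<Rightarrow> ('a, 'v) refword \<Rightarrow> ('a, 'v) refword \<Rightarrow> ('a, 'v) refword \<Rightarrow> bool" where
  "nearest_factor x p q v \<longleftrightarrow>
     (\<exists>t. p = q @ [Open x] @ v @ [Close x] @ t \<and>
          Open x \<notin> set v \<and> Close x \<notin> set v \<and> Close x \<notin> set t)"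

definition nearest ::
  "'v \<Rightarrow> ('a, 'v) refword \<Rightarrow> (('a, 'v) refword \<times> ('a, 'v) refword) option" where
  "nearest x p = (if \<exists>q v. nearest_factor x p q v
                 then Some (SOME (q, v). nearest_factor x p q v) else None)"

lemma append_Cons_eq_last:
  assumes "u @ c # t = u' @ c # t'" "c \<notin> set t" "c \<notin> set t'"
  shows "u = u'"
proof -
  have "takeWhile (\<lambda>d. d \<noteq> c) (rev t @ c # w) = rev t" if "c \<notin> set t" for t w
    using that by (simp add: takeWhile_append)
  from this[OF assms(2), of "rev u"] this[OF assms(3), of "rev u'"]
  have "rev t = rev t'"
    using arg_cong[OF assms(1), of rev] by simp
  then show ?thesis using assms(1) by simp
qed

lemma nearest_factor_unique:
  assumes "nearest_factor x p q v" "nearest_factor x p q' v'"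
  shows "q = q' \<and> v = v'"
proof -
  obtain t where t: "p = (q @ Open x # v) @ Close x # t" "Open x \<notin> set v" "Close x \<notin> set t"
    using assms(1) unfolding nearest_factor_def by auto
  obtain t' where t': "p = (q' @ Open x # v') @ Close x # t'" "Open x \<notin> set v'" "Close x \<notin> set t'"
    using assms(2) unfolding nearest_factor_def by auto
  have eq: "q @ Open x # v = q' @ Open x # v'"
    by (rule append_Cons_eq_last[OF trans[OF t(1)[symmetric] t'(1)] t(3) t'(3)])
  then have "q = q'" by (rule append_Cons_eq_last[OF _ t(2) t'(2)])
  with eq show ?thesis by simp
qed

lemma nearest_eq_Some_iff: "nearest x p = Some (q, v) \<longleftrightarrow> nearest_factor x p q v"
proof -
  have *: "nearest x p = Some (q', v')" if "nearest_factor x p q' v'" for q' v'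
  proof -
    have "(SOME (q, v). nearest_factor x p q v) = (q', v')"
    proof (rule some_equality)
      fix z assume "case z of (q, v) \<Rightarrow> nearest_factor x p q v"
      then show "z = (q', v')"
        using nearest_factor_unique[OF that] by (cases z) simp
    qed (simp add: that)
    moreover have "\<exists>q v. nearest_factor x p q v" using that by blast
    ultimately show ?thesis by (simp add: nearest_def)
  qed
  show ?thesis
  proof
    assume l: "nearest x p = Some (q, v)"
    then obtain q' v' where n: "nearest_factor x p q' v'"
      unfolding nearest_def by (metis option.distinct(1))
    with *[OF n] l show "nearest_factor x p q v" by simp
  qed (rule *)
qed

lemma nearest_eq_None_iff: "nearest x p = None \<longleftrightarrow> (\<forall>q v. \<not> nearest_factor x p q v)"
  unfolding nearest_def by auto

text \<open>\<open>deref_from p s\<close> is the contribution of \<open>s\<close> to the dereference of \<open>p @ s\<close>. When a variable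
  is replaced by \<open>v\<close>, the variables inside \<open>v\<close> refer to the factors to the left of \<^emph>\<open>their\<close>
  position, hence the change of the left context.\<close>

function (sequential) deref_from :: "('a, 'v) refword \<Rightarrow> ('a, 'v) refword \<Rightarrow> 'a list" where
  "deref_from p [] = []"
| "deref_from p (Term a # s) = a # deref_from (p @ [Term a]) s"
| "deref_from p (Var x # s) =
     (case nearest x p of None \<Rightarrow> [] | Some (q, v) \<Rightarrow> deref_from (q @ [Open x]) v)
     @ deref_from (p @ [Var x]) s"
| "deref_from p (Open x # s) = deref_from (p @ [Open x]) s"
| "deref_from p (Close x # s) = deref_from (p @ [Close x]) s"
  by pat_completeness auto
termination
  by (relation "measures [\<lambda>(p, s). length p + length s, \<lambda>(p, s). length s]")
    (auto simp: nearest_eq_Some_iff nearest_factor_def)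

definition deref :: "('a, 'v) refword \<Rightarrow> 'a list" where
  "deref r = deref_from [] r"

definition lang :: "('a, 'v) regex \<Rightarrow> 'a list set" where
  "lang \<alpha> = deref ` ref_lang \<alpha>"

datatype 'c rexp =
    Zero
  | One
  | Atom 'c
  | Times "'c rexp" "'c rexp"
  | Choice "'c rexp" "'c rexp"
  | Repeat "'c rexp"  \<comment> \<open>one or more repetitions\<close>

primrec rexp_lang :: "'c rexp \<Rightarrow> 'c list set" where
  "rexp_lang Zero = {}"
| "rexp_lang One = {[]}"
| "rexp_lang (Atom c) = {[c]}"
| "rexp_lang (Times e f) = conc (rexp_lang e) (rexp_lang f)"
| "rexp_lang (Choice e f) = rexp_lang e \<union> rexp_lang f"
| "rexp_lang (Repeat e) = iter (rexp_lang e)"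

primrec ref_rexp :: "('a, 'v) regex \<Rightarrow> ('a, 'v) rsym rexp" where
  "ref_rexp EmptySet = Zero"
| "ref_rexp Eps = One"
| "ref_rexp (Sym a) = Atom (Term a)"
| "ref_rexp (Ref x) = Atom (Var x)"
| "ref_rexp (Cat \<alpha> \<beta>) = Times (ref_rexp \<alpha>) (ref_rexp \<beta>)"
| "ref_rexp (Alt \<alpha> \<beta>) = Choice (ref_rexp \<alpha>) (ref_rexp \<beta>)"
| "ref_rexp (Iter \<alpha>) = Repeat (ref_rexp \<alpha>)"
| "ref_rexp (Bind x \<alpha>) = Times (Atom (Open x)) (Times (ref_rexp \<alpha>) (Atom (Close x)))"

lemma rexp_lang_ref_rexp: "rexp_lang (ref_rexp \<alpha>) = ref_lang \<alpha>"
  by (induction \<alpha>) simp_all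

primrec atoms :: "'c rexp \<Rightarrow> nat" where
  "atoms Zero = 0"
| "atoms One = 0"
| "atoms (Atom c) = 1"
| "atoms (Times e f) = atoms e + atoms f"
| "atoms (Choice e f) = atoms e + atoms f"
| "atoms (Repeat e) = atoms e"

text \<open>\<open>mark n e\<close> numbers the symbol occurrences of \<open>e\<close> from left to right by
  \<open>n, n + 1, \<dots>, n + atoms e - 1\<close>.\<close>

primrec mark :: "nat \<Rightarrow> 'c rexp \<Rightarrow> ('c \<times> nat) rexp" where
  "mark n Zero = Zero"
| "mark n One = One"
| "mark n (Atom c) = Atom (c, n)"
| "mark n (Times e f) = Times (mark n e) (mark (n + atoms e) f)"
| "mark n (Choice e f) = Choice (mark n e) (mark (n + atoms e) f)"
| "mark n (Repeat e) = Repeat (mark n e)"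

definition marked_lang :: "('a, 'v) regex \<Rightarrow> (('a, 'v) rsym \<times> nat) list set" where
  "marked_lang \<alpha> = rexp_lang (mark 0 (ref_rexp \<alpha>))"

definition marked_brackets :: "(('a, 'v) rsym \<times> nat) set" where
  "marked_brackets = (range Open \<union> range Close) \<times> UNIV"

definition nondeterministic :: "('a, 'v) regex \<Rightarrow> bool" where
  "nondeterministic \<alpha> \<longleftrightarrow>
    (\<exists>\<rho>1 \<in> marked_lang \<alpha>. \<exists>\<rho>2 \<in> marked_lang \<alpha>.
     \<exists>r s1 s2. \<exists>\<gamma>1 \<in> lists marked_brackets. \<exists>\<gamma>2 \<in> lists marked_brackets.
       (\<exists>a i j. \<rho>1 = r @ \<gamma>1 @ [(Term a, i)] @ s1 \<and> \<rho>2 = r @ \<gamma>2 @ [(Term a, j)] @ s2 \<and> i \<noteq> j) \<or>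
       (\<exists>x \<chi> i j. \<rho>1 = r @ \<gamma>1 @ [(Var x, i)] @ s1 \<and> \<rho>2 = r @ \<gamma>2 @ [(\<chi>, j)] @ s2 \<and>
          \<chi> \<in> range Term \<union> range Var \<and> i \<noteq> j) \<or>
       (\<exists>\<chi> i. \<rho>1 = r @ \<gamma>1 @ [(\<chi>, i)] @ s1 \<and> \<rho>2 = r @ \<gamma>2 @ [(\<chi>, i)] @ s2 \<and>
          \<chi> \<in> range Term \<union> range Var \<and> \<gamma>1 \<noteq> \<gamma>2) \<or>
       (\<rho>1 = r @ \<gamma>1 \<and> \<rho>2 = r @ \<gamma>2 \<and> \<gamma>1 \<noteq> \<gamma>2))"

definition DRX :: "('a, 'v) regex set" where
  "DRX = {\<alpha> \<in> RX. \<not> nondeterministic \<alpha>}"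

definition frac_pow :: "'a list \<Rightarrow> rat \<Rightarrow> 'a list" where
  "frac_pow w q = concat (replicate (nat \<lfloor>q\<rfloor>) w) @ take (nat \<lfloor>frac q * of_nat (length w)\<rfloor>) w"

lemma frac_pow_eq:
  assumes "w \<noteq> []" "i \<le> length w"
  shows "frac_pow w (of_nat m + of_nat i / of_nat (length w)) = concat (replicate m w) @ take i w"
proof (cases "i = length w")
  case True
  have "frac_pow w (of_nat (Suc m)) = concat (replicate (Suc m) w)"
    unfolding frac_pow_def by (simp add: frac_def flip: of_nat_Suc)
  also have "\<dots> = concat (replicate m w) @ take i w"
    using True by (simp flip: replicate_append_same)
  finally show ?thesis using True assms by (simp add: add.commute)
next
  case False
  let ?n = "of_nat (length w) :: rat"
  have n: "?n > 0" and f: "0 \<le> of_nat i / ?n" "of_nat i / ?n < 1"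
    using assms False by auto
  then have "\<lfloor>of_nat m + of_nat i / ?n\<rfloor> = int m"
    by (simp add: floor_eq_iff)
  moreover from this have "frac (of_nat m + of_nat i / ?n) * ?n = of_nat i"
    using n by (simp add: frac_def)
  ultimately show ?thesis unfolding frac_pow_def by simp
qed

end

theory Submission imports Defs begin

text \<open>Let \<open>\<alpha>\<close> be a deterministic regex for the language. Since the words of the language form a chain
  under the prefix order, determinism forces the marked ref-words of \<open>\<alpha>\<close>, up to trailing brackets,
  to form a chain too. As this chain is infinite, some mark repeats and hence lies inside an iteration
  \<open>\<beta>\<^sup>+\<close>. Wherever a word may end inside \<open>\<beta>\<^sup>+\<close>, it may also continue with the first symbol of \<open>\<beta>\<close>,
  so by the chain property it must. It follows that almost all ref-words have the form \<open>p v\<^sup>m s\<close>, with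
  \<open>v\<close> a shortest nonempty word of \<open>\<beta>\<close> and \<open>s\<close> consisting of brackets. To reach all lengths, each
  further copy of \<open>v\<close> contributes at most one letter, and in the alternating language consecutive
  letters differ. But what a copy contributes from the second one on does not depend on its index:
  a variable that is bound in \<open>v\<close> could only repeat a letter just produced.\<close>

section \<open>Marked regular expressions\<close>

text \<open>No atom occurs twice in such an expression. Marking produces expressions of this kind,
  and their languages are local.\<close>

primrec linear_rexp :: "'c rexp \<Rightarrow> bool" where
  "linear_rexp Zero \<longleftrightarrow> True"
| "linear_rexp One \<longleftrightarrow> True"
| "linear_rexp (Atom c) \<longleftrightarrow> True"
| "linear_rexp (Times e f) \<longleftrightarrow> linear_rexp e \<and> linear_rexp f \<and> set_rexp e \<inter> set_rexp f = {}"
| "linear_rexp (Choice e f) \<longleftrightarrow> linear_rexp e \<and> linear_rexp f \<and> set_rexp e \<inter> set_rexp f = {}"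
| "linear_rexp (Repeat e) \<longleftrightarrow> linear_rexp e"

primrec repeats :: "'c rexp \<Rightarrow> 'c rexp set" where
  "repeats Zero = {}"
| "repeats One = {}"
| "repeats (Atom c) = {}"
| "repeats (Times e f) = repeats e \<union> repeats f"
| "repeats (Choice e f) = repeats e \<union> repeats f"
| "repeats (Repeat e) = insert e (repeats e)"

section \<open>Concatenation and iteration of languages\<close>

lemma concI: "u \<in> A \<Longrightarrow> v \<in> B \<Longrightarrow> u @ v \<in> conc A B"
  unfolding conc_def by blast

lemma concE:
  assumes "w \<in> conc A B"
  obtains u v where "w = u @ v" "u \<in> A" "v \<in> B"
  using assms unfolding conc_def by blast

lemma conc_assoc: "conc (conc A B) C = conc A (conc B C)"
  unfolding conc_def by (auto, (metis append.assoc)+)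

lemma iterI: "ws \<noteq> [] \<Longrightarrow> set ws \<subseteq> A \<Longrightarrow> concat ws \<in> iter A"
  unfolding iter_def by blast

lemma iterE:
  assumes "w \<in> iter A"
  obtains ws where "w = concat ws" "ws \<noteq> []" "set ws \<subseteq> A"
  using assms unfolding iter_def by blast

lemma map_conc: "map f ` conc A B = conc (map f ` A) (map f ` B)"
  unfolding conc_def by (auto simp: image_iff) (metis map_append)+

lemma map_iter: "map f ` iter A = iter (map f ` A)"
proof (intro equalityI subsetI)
  fix w assume "w \<in> map f ` iter A"
  then obtain z where z: "w = map f z" "z \<in> iter A" by blast
  from z(2) obtain ws where ws: "z = concat ws" "ws \<noteq> []" "set ws \<subseteq> A" by (rule iterE)
  then have "concat (map (map f) ws) \<in> iter (map f ` A)" by (intro iterI) auto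
  then show "w \<in> iter (map f ` A)" using z ws by (simp add: map_concat)
next
  fix w assume "w \<in> iter (map f ` A)"
  then obtain ws where ws: "w = concat ws" "ws \<noteq> []" "set ws \<subseteq> map f ` A" by (rule iterE)
  then have "ws \<in> map (map f) ` lists A" unfolding lists_image[symmetric] by blast
  then obtain vs where vs: "ws = map (map f) vs" "set vs \<subseteq> A" by auto
  then have "concat vs \<in> iter A" using ws by (intro iterI) auto
  moreover have "w = map f (concat vs)" using ws vs by (simp add: map_concat)
  ultimately show "w \<in> map f ` iter A" by blast
qed

section \<open>Numbers attached by the marking\<close>

lemma rexp_lang_mark: "map fst ` rexp_lang (mark n e) = rexp_lang e"
  by (induction e arbitrary: n) (simp_all add: map_conc map_iter image_Un)

lemma set_mark: "c \<in> set_rexp (mark n e) \<Longrightarrow> n \<le> snd c \<and> snd c < n + atoms e"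
  by (induction e arbitrary: n) force+

text \<open>The left operand uses numbers below \<open>n + atoms e\<close>, and the right one starts
  there.\<close>

lemma set_mark_disjoint: "snd ` set_rexp (mark n e) \<inter> snd ` set_rexp (mark (n + atoms e) f) = {}"
  using set_mark[of _ n e] set_mark[of _ "n + atoms e" f] by (fastforce simp: image_iff)

lemma linear_mark: "linear_rexp (mark n e)"
proof (induction e arbitrary: n)
  case (Times e f)
  then show ?case using set_mark_disjoint[of n e f] by auto
next
  case (Choice e f)
  then show ?case using set_mark_disjoint[of n e f] by auto
qed auto

text \<open>Distinct marked symbols thus carry distinct numbers, as the conditions
  \<open>i \<noteq> j\<close> in \<open>nondeterministic\<close> require.\<close>

lemma inj_on_mark: "inj_on snd (set_rexp (mark n e))"
proof (induction e arbitrary: n)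
  case (Times e f)
  then show ?case using set_mark_disjoint[of n e f] by (auto simp: inj_on_Un)
next
  case (Choice e f)
  then show ?case using set_mark_disjoint[of n e f] by (auto simp: inj_on_Un)
qed auto

lemma finite_set_rexp: "finite (set_rexp e)"
  by (induction e) auto

lemma set_rexp_lang: "w \<in> rexp_lang e \<Longrightarrow> set w \<subseteq> set_rexp e"
proof (induction e arbitrary: w)
  case (Repeat e)
  then show ?case by (fastforce elim!: iterE)
qed (auto elim!: concE, blast+)

lemma repeats_linear: "linear_rexp e \<Longrightarrow> \<beta> \<in> repeats e \<Longrightarrow> linear_rexp \<beta>"
  by (induction e) auto

text \<open>Iteration bodies are again markings of a regex, so \<open>ref_lang_Close\<close> applies
  to their words once the marks are erased.\<close>

lemma repeats_mark_ref_rexp: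
  "\<beta> \<in> repeats (mark n (ref_rexp \<alpha>)) \<Longrightarrow> \<exists>\<alpha>' k. \<beta> = mark k (ref_rexp \<alpha>')"
  by (induction \<alpha> arbitrary: n) auto

lemma append_split:
  assumes "u @ v = x @ c # y"
  obtains q where "u = x @ c # q" "y = q @ v"
  | x' where "x = u @ x'" "v = x' @ c # y"
  using assms by (auto simp: append_eq_append_conv2 append_eq_Cons_conv Cons_eq_append_conv)

lemma concat_split:
  "concat ws = x @ c # y \<Longrightarrow>
   \<exists>us p q vs. ws = us @ (p @ c # q) # vs \<and> x = concat us @ p \<and> y = q @ concat vs"
proof (induction ws arbitrary: x)
  case (Cons w ws)
  then have "w @ concat ws = x @ c # y" by simp
  then show ?case
  proof (rule append_split)
    fix q assume "w = x @ c # q" "y = q @ concat ws"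
    then have "w # ws = [] @ (x @ c # q) # ws \<and> x = concat [] @ x \<and> y = q @ concat ws" by simp
    then show ?thesis by blast
  next
    fix x' assume x': "x = w @ x'" "concat ws = x' @ c # y"
    from Cons.IH[OF x'(2)] obtain us p q vs where
      "ws = us @ (p @ c # q) # vs" "x' = concat us @ p" "y = q @ concat vs"
      by (elim exE conjE) (rule that)
    then have "w # ws = (w # us) @ (p @ c # q) # vs \<and> x = concat (w # us) @ p \<and> y = q @ concat vs"
      using x'(1) by simp
    then show ?thesis by blast
  qed
qed simp

text \<open>Languages of linear expressions are local: the possible continuations of a word depend only
  on its last letter.\<close>

lemma linear_exchange:
  assumes "linear_rexp e" "x @ c # y \<in> rexp_lang e" "x' @ c # y' \<in> rexp_lang e"
  shows "x @ c # y' \<in> rexp_lang e"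
  using assms
proof (induction e arbitrary: x y x' y')
  case (Times e f)
  from Times.prems(2) obtain u v where uv: "x @ c # y = u @ v" "u \<in> rexp_lang e" "v \<in> rexp_lang f"
    by (auto elim!: concE)
  from Times.prems(3) obtain u' v' where uv': "x' @ c # y' = u' @ v'" "u' \<in> rexp_lang e" "v' \<in> rexp_lang f"
    by (auto elim!: concE)
  note sets = set_rexp_lang[OF uv(2)] set_rexp_lang[OF uv(3)]
    set_rexp_lang[OF uv'(2)] set_rexp_lang[OF uv'(3)]
  have disj: "set_rexp e \<inter> set_rexp f = {}" using Times.prems by simp
  from uv(1)[symmetric] show ?case
  proof (rule append_split)
    fix q assume 1: "u = x @ c # q" "y = q @ v"
    from uv'(1)[symmetric] show ?thesis
    proof (rule append_split)
      fix q' assume 2: "u' = x' @ c # q'" "y' = q' @ v'"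
      have "x @ c # q' \<in> rexp_lang e"
        using Times.IH(1)[of x q x' q'] Times.prems(1) uv(2) uv'(2) by (simp add: 1 2)
      then have "(x @ c # q') @ v' \<in> rexp_lang (Times e f)"
        using uv'(3) unfolding rexp_lang.simps by (rule concI)
      then show ?thesis using 2 by simp
    next
      fix x'' assume "x' = u' @ x''" "v' = x'' @ c # y'"
      \<comment> \<open>Here \<open>c\<close> would be an atom of both \<open>e\<close> and
        \<open>f\<close>.\<close>
      then show ?thesis using 1 sets disj by auto
    qed
  next
    fix x1 assume 1: "x = u @ x1" "v = x1 @ c # y"
    from uv'(1)[symmetric] show ?thesis
    proof (rule append_split)
      fix q' assume 2: "u' = x' @ c # q'" "y' = q' @ v'"
      then show ?thesis using 1 sets disj by auto
    next
      fix x'' assume 2: "x' = u' @ x''" "v' = x'' @ c # y'"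
      have "x1 @ c # y' \<in> rexp_lang f"
        using Times.IH(2)[of x1 y x'' y'] Times.prems(1) uv(3) uv'(3) by (simp add: 1 2)
      with uv(2) have "u @ (x1 @ c # y') \<in> rexp_lang (Times e f)"
        unfolding rexp_lang.simps by (rule concI)
      then show ?thesis using 1 by simp
    qed
  qed
next
  case (Choice e f)
  have disj: "set_rexp e \<inter> set_rexp f = {}" using Choice.prems by simp
  have c: "c \<in> set_rexp g" if "z @ c # z' \<in> rexp_lang g" for z z' and g
    using set_rexp_lang[OF that] by simp
  have lin: "linear_rexp e" "linear_rexp f" using Choice.prems by simp_all
  from Choice.prems(2,3)[unfolded rexp_lang.simps Un_iff] c disj consider
    "x @ c # y \<in> rexp_lang e" "x' @ c # y' \<in> rexp_lang e"
    | "x @ c # y \<in> rexp_lang f" "x' @ c # y' \<in> rexp_lang f" by blast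
  then show ?case
  proof cases
    case 1
    show ?thesis using Choice.IH(1)[OF lin(1) 1] by simp
  next
    case 2
    show ?thesis using Choice.IH(2)[OF lin(2) 2] by simp
  qed
next
  case (Repeat e)
  from Repeat.prems(2) obtain ws where ws: "concat ws = x @ c # y" "set ws \<subseteq> rexp_lang e"
    by (auto elim!: iterE)
  from Repeat.prems(3) obtain ws' where ws': "concat ws' = x' @ c # y'" "set ws' \<subseteq> rexp_lang e"
    by (auto elim!: iterE)
  from concat_split[OF ws(1)] obtain us p q vs where 1:
    "ws = us @ (p @ c # q) # vs" "x = concat us @ p"
    by (elim exE conjE) (rule that)
  from concat_split[OF ws'(1)] obtain us' p' q' vs' where 2:
    "ws' = us' @ (p' @ c # q') # vs'" "y' = q' @ concat vs'"
    by (elim exE conjE) (rule that)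
  \<comment> \<open>Only the two blocks containing \<open>c\<close> are spliced; earlier blocks come
    from the first word, later ones from the second.\<close>
  have "p @ c # q' \<in> rexp_lang e"
    using Repeat.IH[of p q p' q'] Repeat.prems(1) ws(2) ws'(2) by (simp add: 1 2)
  then have "concat (us @ (p @ c # q') # vs') \<in> iter (rexp_lang e)"
    using 1 2 ws ws' by (intro iterI) auto
  then show ?case using 1 2 by simp
qed (auto simp: append_eq_Cons_conv Cons_eq_append_conv)

text \<open>\<open>N\<close> selects the symbols that count, later the terminals and variables as
  opposed to brackets. The clause on \<open>v\<close> excludes iterations that produce ignored
  symbols only. As \<open>P\<close> and \<open>S\<close> avoid the atoms of \<beta>, the symbols
  that stem from the iteration are recognisable.\<close>

definition repeat_context ::
  "('c \<Rightarrow> bool) \<Rightarrow> 'c rexp \<Rightarrow> 'c rexp \<Rightarrow> 'c list set \<Rightarrow> 'c list set \<Rightarrow> bool" where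
  "repeat_context N e \<beta> P S \<longleftrightarrow>
    \<beta> \<in> repeats e \<and> P \<noteq> {} \<and> S \<noteq> {} \<and> (\<exists>v\<in>rexp_lang \<beta>. filter N v \<noteq> []) \<and>
    (\<forall>w\<in>P \<union> S. set w \<inter> set_rexp \<beta> = {}) \<and> set_rexp \<beta> \<subseteq> set_rexp e \<and>
    conc P (conc (iter (rexp_lang \<beta>)) S) \<subseteq> rexp_lang e \<and>
    (\<forall>w\<in>rexp_lang e. set w \<inter> set_rexp \<beta> \<noteq> {} \<longrightarrow> w \<in> conc P (conc (iter (rexp_lang \<beta>)) S))"

text \<open>Taking the outermost iteration \<open>\<beta>\<^sup>+\<close> ensures that the words passing through \<open>\<beta>\<close> factorise
  as \<open>P \<beta>\<^sup>+ S\<close>.\<close>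

lemma linear_repeat_context:
  assumes "linear_rexp e" "\<rho> \<in> rexp_lang e" "\<not> distinct (filter N \<rho>)"
  shows "\<exists>\<beta> P S. repeat_context N e \<beta> P S"
  using assms
proof (induction e arbitrary: \<rho>)
  case (Times e f)
  from Times.prems(2) obtain u v where uv: "\<rho> = u @ v" "u \<in> rexp_lang e" "v \<in> rexp_lang f"
    by (auto elim!: concE)
  have disj: "set_rexp e \<inter> set_rexp f = {}" using Times.prems by simp
  \<comment> \<open>As \<open>e\<close> and \<open>f\<close> share no atom, the repeated symbol
    repeats within one of the two factors.\<close>
  have "set u \<inter> set v = {}" using set_rexp_lang[OF uv(2)] set_rexp_lang[OF uv(3)] disj by blast
  then consider "\<not> distinct (filter N u)" | "\<not> distinct (filter N v)"
    using Times.prems(3) uv(1) by fastforce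
  then show ?case
  proof cases
    case 1
    with Times.IH(1)[OF _ uv(2)] Times.prems(1) obtain \<beta> P S where
      ctx: "repeat_context N e \<beta> P S" by auto
    from ctx[unfolded repeat_context_def] have b: "\<beta> \<in> repeats e" "P \<noteq> {}" "S \<noteq> {}" "\<exists>v\<in>rexp_lang \<beta>. filter N v \<noteq> []"
        "\<forall>w\<in>P \<union> S. set w \<inter> set_rexp \<beta> = {}" "set_rexp \<beta> \<subseteq> set_rexp e"
        "conc P (conc (iter (rexp_lang \<beta>)) S) \<subseteq> rexp_lang e"
        "\<And>w. w\<in>rexp_lang e \<Longrightarrow> set w \<inter> set_rexp \<beta> \<noteq> {} \<Longrightarrow> w \<in> conc P (conc (iter (rexp_lang \<beta>)) S)"
      by blast+
    have fb: "set w \<inter> set_rexp \<beta> = {}" if "w \<in> rexp_lang f" for w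
      using set_rexp_lang[OF that] b(6) disj by blast
    have eq: "conc P (conc (iter (rexp_lang \<beta>)) (conc S (rexp_lang f))) =
      conc (conc P (conc (iter (rexp_lang \<beta>)) S)) (rexp_lang f)"
      by (simp add: conc_assoc)
    have A: "conc S (rexp_lang f) \<noteq> {}" using b(3) uv by (auto intro: concI)
    have B: "\<forall>w\<in>P \<union> conc S (rexp_lang f). set w \<inter> set_rexp \<beta> = {}"
      using b(5) fb by (auto elim!: concE) blast+
    have C: "conc P (conc (iter (rexp_lang \<beta>)) (conc S (rexp_lang f))) \<subseteq> rexp_lang (Times e f)"
      unfolding eq using b(7) by (auto elim!: concE intro!: concI)
    have D: "w \<in> conc P (conc (iter (rexp_lang \<beta>)) (conc S (rexp_lang f)))"
      if w: "w \<in> rexp_lang (Times e f)" "set w \<inter> set_rexp \<beta> \<noteq> {}" for w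
    proof -
      from w(1) obtain u v where uv: "w = u @ v" "u \<in> rexp_lang e" "v \<in> rexp_lang f"
        by (auto elim!: concE)
      then have "u \<in> conc P (conc (iter (rexp_lang \<beta>)) S)"
        using b(8)[OF uv(2)] fb[OF uv(3)] w(2) by auto
      then show ?thesis unfolding eq uv(1) using uv(3) by (rule concI)
    qed
    have "repeat_context N (Times e f) \<beta> P (conc S (rexp_lang f))"
      unfolding repeat_context_def using b(1,2,4,6) A B C D by auto
    then show ?thesis by blast
  next
    case 2
    with Times.IH(2)[OF _ uv(3)] Times.prems(1) obtain \<beta> P S where
      ctx: "repeat_context N f \<beta> P S" by auto
    from ctx[unfolded repeat_context_def] have b: "\<beta> \<in> repeats f" "P \<noteq> {}" "S \<noteq> {}" "\<exists>v\<in>rexp_lang \<beta>. filter N v \<noteq> []"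
        "\<forall>w\<in>P \<union> S. set w \<inter> set_rexp \<beta> = {}" "set_rexp \<beta> \<subseteq> set_rexp f"
        "conc P (conc (iter (rexp_lang \<beta>)) S) \<subseteq> rexp_lang f"
        "\<And>w. w\<in>rexp_lang f \<Longrightarrow> set w \<inter> set_rexp \<beta> \<noteq> {} \<Longrightarrow> w \<in> conc P (conc (iter (rexp_lang \<beta>)) S)"
      by blast+
    have fb: "set w \<inter> set_rexp \<beta> = {}" if "w \<in> rexp_lang e" for w
      using set_rexp_lang[OF that] b(6) disj by blast
    have eq: "conc (conc (rexp_lang e) P) (conc (iter (rexp_lang \<beta>)) S) =
      conc (rexp_lang e) (conc P (conc (iter (rexp_lang \<beta>)) S))"
      by (simp add: conc_assoc)
    have A: "conc (rexp_lang e) P \<noteq> {}" using b(2) uv by (auto intro: concI)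
    have B: "\<forall>w\<in>conc (rexp_lang e) P \<union> S. set w \<inter> set_rexp \<beta> = {}"
      using b(5) fb by (auto elim!: concE) blast+
    have C: "conc (conc (rexp_lang e) P) (conc (iter (rexp_lang \<beta>)) S) \<subseteq> rexp_lang (Times e f)"
      unfolding eq using b(7) by (auto elim!: concE intro!: concI)
    have D: "w \<in> conc (conc (rexp_lang e) P) (conc (iter (rexp_lang \<beta>)) S)"
      if w: "w \<in> rexp_lang (Times e f)" "set w \<inter> set_rexp \<beta> \<noteq> {}" for w
    proof -
      from w(1) obtain u v where uv: "w = u @ v" "u \<in> rexp_lang e" "v \<in> rexp_lang f"
        by (auto elim!: concE)
      then have "v \<in> conc P (conc (iter (rexp_lang \<beta>)) S)"
        using b(8)[OF uv(3)] fb[OF uv(2)] w(2) by auto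
      with uv(2) show ?thesis unfolding eq uv(1) by (rule concI)
    qed
    have "repeat_context N (Times e f) \<beta> (conc (rexp_lang e) P) S"
      unfolding repeat_context_def using b(1,3,4,6) A B C D by auto
    then show ?thesis by blast
  qed
next
  case (Choice e f)
  have disj: "set_rexp e \<inter> set_rexp f = {}" using Choice.prems by simp
  have D: "set w \<inter> set_rexp \<beta> = {}"
    if "w \<in> rexp_lang g" "set_rexp \<beta> \<subseteq> set_rexp h" "set_rexp g \<inter> set_rexp h = {}" for w g h and \<beta> :: "'a rexp"
    using set_rexp_lang[OF that(1)] that by blast
  from Choice.prems(2) consider "\<rho> \<in> rexp_lang e" | "\<rho> \<in> rexp_lang f" by auto
  then show ?case
  proof cases
    case 1
    with Choice.IH(1)[OF _ 1] Choice.prems(1,3) obtain \<beta> P S where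
      ctx: "repeat_context N e \<beta> P S" by auto
    from ctx[unfolded repeat_context_def] have b: "\<beta> \<in> repeats e" "P \<noteq> {}" "S \<noteq> {}" "\<exists>v\<in>rexp_lang \<beta>. filter N v \<noteq> []"
        "\<forall>w\<in>P \<union> S. set w \<inter> set_rexp \<beta> = {}" "set_rexp \<beta> \<subseteq> set_rexp e"
        "conc P (conc (iter (rexp_lang \<beta>)) S) \<subseteq> rexp_lang e"
        "\<forall>w\<in>rexp_lang e. set w \<inter> set_rexp \<beta> \<noteq> {} \<longrightarrow> w \<in> conc P (conc (iter (rexp_lang \<beta>)) S)"
      by blast+
    have "w \<in> conc P (conc (iter (rexp_lang \<beta>)) S)"
      if "w \<in> rexp_lang (Choice e f)" "set w \<inter> set_rexp \<beta> \<noteq> {}" for w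
    proof -
      have "w \<notin> rexp_lang f" using D[OF _ b(6), of w f] disj that(2) by blast
      then show ?thesis using b(8) that by simp
    qed
    then have "repeat_context N (Choice e f) \<beta> P S"
      unfolding repeat_context_def using b(1-7) by auto
    then show ?thesis by blast
  next
    case 2
    with Choice.IH(2)[OF _ 2] Choice.prems(1,3) obtain \<beta> P S where
      ctx: "repeat_context N f \<beta> P S" by auto
    from ctx[unfolded repeat_context_def] have b: "\<beta> \<in> repeats f" "P \<noteq> {}" "S \<noteq> {}" "\<exists>v\<in>rexp_lang \<beta>. filter N v \<noteq> []"
        "\<forall>w\<in>P \<union> S. set w \<inter> set_rexp \<beta> = {}" "set_rexp \<beta> \<subseteq> set_rexp f"
        "conc P (conc (iter (rexp_lang \<beta>)) S) \<subseteq> rexp_lang f"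
        "\<forall>w\<in>rexp_lang f. set w \<inter> set_rexp \<beta> \<noteq> {} \<longrightarrow> w \<in> conc P (conc (iter (rexp_lang \<beta>)) S)"
      by blast+
    have "w \<in> conc P (conc (iter (rexp_lang \<beta>)) S)"
      if "w \<in> rexp_lang (Choice e f)" "set w \<inter> set_rexp \<beta> \<noteq> {}" for w
    proof -
      have "w \<notin> rexp_lang e" using D[OF _ b(6), of w e] disj that(2) by blast
      then show ?thesis using b(8) that by simp
    qed
    then have "repeat_context N (Choice e f) \<beta> P S"
      unfolding repeat_context_def using b(1-7) by auto
    then show ?thesis by blast
  qed
next
  case (Repeat e)
  from Repeat.prems(2) obtain ws where ws: "\<rho> = concat ws" "set ws \<subseteq> rexp_lang e"
    by (auto elim!: iterE)
  \<comment> \<open>Otherwise the filtered word would be empty, hence distinct.\<close>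
  have "\<exists>v\<in>set ws. filter N v \<noteq> []"
  proof (rule ccontr)
    assume "\<not> ?thesis"
    then have "filter N (concat ws) = []" by (induction ws) auto
    then show False using Repeat.prems(3) ws by simp
  qed
  then have "\<exists>v\<in>rexp_lang e. filter N v \<noteq> []" using ws by blast
  moreover have "conc {[]} (conc (iter (rexp_lang e)) {[]}) = iter (rexp_lang e)"
    unfolding conc_def by auto
  ultimately have "repeat_context N (Repeat e) e {[]} {[]}"
    unfolding repeat_context_def by auto
  then show ?case by blast
qed (auto split: if_splits)

section \<open>Chains of marked words\<close>

text \<open>The only freedom left is that one word ends where another continues; the ignored symbols
  at its end may then differ from those of the longer word.\<close>

definition chain :: "('c \<Rightarrow> bool) \<Rightarrow> 'c list set \<Rightarrow> bool" where
  "chain N M \<longleftrightarrow>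
    (\<forall>r g1 g2 c d s1 s2. r @ g1 @ c # s1 \<in> M \<longrightarrow> r @ g2 @ d # s2 \<in> M \<longrightarrow>
       filter N g1 = [] \<longrightarrow> filter N g2 = [] \<longrightarrow> N c \<longrightarrow> N d \<longrightarrow> c = d \<and> g1 = g2) \<and>
    (\<forall>r g1 g2. r @ g1 \<in> M \<longrightarrow> r @ g2 \<in> M \<longrightarrow>
       filter N g1 = [] \<longrightarrow> filter N g2 = [] \<longrightarrow> g1 = g2)"

text \<open>Trailing ignored symbols are cut off because a chain does not compare them with a longer
  word.\<close>

lemma split_trimmed:
  obtains x g where "\<rho> = x @ g" "x = [] \<or> N (last x)" "filter N g = []"
proof -
  have "\<exists>x g. \<rho> = x @ g \<and> (x = [] \<or> N (last x)) \<and> filter N g = []"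
  proof (induction \<rho> rule: rev_induct)
    case (snoc c \<rho>)
    then obtain x g where "\<rho> = x @ g" "x = [] \<or> N (last x)" "filter N g = []" by blast
    then show ?case
    proof (cases "N c")
      case True
      then show ?thesis by (intro exI[of _ "\<rho> @ [c]"] exI[of _ "[]"]) simp
    next
      case False
      then show ?thesis
        using \<open>\<rho> = x @ g\<close> \<open>x = [] \<or> N (last x)\<close> \<open>filter N g = []\<close>
        by (intro exI[of _ x] exI[of _ "g @ [c]"]) simp
    qed
  qed auto
  then show ?thesis using that by blast
qed

text \<open>Induction on the number of counted symbols: the last one, with the ignored symbols
  before it, is determined by the prefix up to the previous one.\<close>

lemma chain_align:
  assumes "chain N M"
    and "x1 @ s1 \<in> M" "x1 = [] \<or> N (last x1)"
    and "x2 @ s2 \<in> M" "x2 = [] \<or> N (last x2)"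
    and "length (filter N x1) = length (filter N x2)"
  shows "x1 = x2"
  using assms(2-)
proof (induction "length (filter N x1)" arbitrary: x1 s1 x2 s2)
  case 0
  have "x = []" if "length (filter N x) = 0" "x = [] \<or> N (last x)" for x
    using that by (cases x rule: rev_cases) auto
  then show ?case using 0 by metis
next
  case (Suc n)
  have ex: "\<exists>y g c. x = y @ g @ [c] \<and> N c \<and> (y = [] \<or> N (last y)) \<and> filter N g = []
      \<and> length (filter N y) = n" if x: "length (filter N x) = Suc n" "x = [] \<or> N (last x)" for x
  proof -
    obtain z c where z: "x = z @ [c]" "N c" using x by (cases x rule: rev_cases) auto
    obtain y g where "z = y @ g" "y = [] \<or> N (last y)" "filter N g = []" by (rule split_trimmed)
    then show ?thesis using z x by auto
  qed
  from ex[of x1] Suc.hyps(2) Suc.prems obtain y1 g1 c1 where 1: "x1 = y1 @ g1 @ [c1]" "N c1"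
    "y1 = [] \<or> N (last y1)" "filter N g1 = []" "length (filter N y1) = n" by auto
  from ex[of x2] Suc.hyps(2) Suc.prems obtain y2 g2 c2 where 2: "x2 = y2 @ g2 @ [c2]" "N c2"
    "y2 = [] \<or> N (last y2)" "filter N g2 = []" "length (filter N y2) = n" by auto
  have "y1 = y2"
    using Suc.hyps(1)[of y1 "g1 @ [c1] @ s1" y2 "g2 @ [c2] @ s2"] 1 2 Suc.prems by simp
  then have "c1 = c2 \<and> g1 = g2"
    using assms(1)[unfolded chain_def, THEN conjunct1, rule_format, of y1 g1 c1 s1 g2 c2 s2]
      1 2 Suc.prems by simp
  then show ?case using 1 2 \<open>y1 = y2\<close> by simp
qed

text \<open>Induction on the surplus \<open>l\<close>, removing the last counted symbol and the
  ignored ones after it.\<close>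

lemma filter_split:
  assumes "length (filter N \<rho>) = k + l"
  shows "\<exists>x s. \<rho> = x @ s \<and> (x = [] \<or> N (last x)) \<and> length (filter N x) = k"
  using assms
proof (induction l arbitrary: \<rho>)
  case 0
  then show ?case using split_trimmed[of \<rho> N] by (metis append_Nil2 filter_append add_0_right)
next
  case (Suc l)
  obtain x g where x: "\<rho> = x @ g" "x = [] \<or> N (last x)" "filter N g = []" by (rule split_trimmed)
  with Suc.prems have "x \<noteq> []" by auto
  then obtain y c where y: "x = y @ [c]" by (cases x rule: rev_cases) auto
  with x Suc.prems have "length (filter N y) = k + l" by simp
  from Suc.IH[OF this] obtain z s where "y = z @ s" "z = [] \<or> N (last z)" "length (filter N z) = k"
    by blast
  then show ?case using x y by auto
qed

text \<open>Cut \<rho>2 after as many counted symbols as \<rho>1 has. By \<open>chain_align\<close>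
  this prefix is \<rho>1 without its trailing ignored symbols.\<close>

lemma chain_prefix:
  assumes "chain N M" "\<rho>1 \<in> M" "\<rho>2 \<in> M" "length (filter N \<rho>1) \<le> length (filter N \<rho>2)"
  shows "\<exists>r g t. \<rho>1 = r @ g \<and> \<rho>2 = r @ t \<and> (r = [] \<or> N (last r)) \<and> filter N g = []"
proof -
  obtain x g where x: "\<rho>1 = x @ g" "x = [] \<or> N (last x)" "filter N g = []" by (rule split_trimmed)
  then obtain l where "length (filter N \<rho>2) = length (filter N x) + l"
    using assms(4) le_iff_add by auto
  from filter_split[OF this] obtain y s where y: "\<rho>2 = y @ s" "y = [] \<or> N (last y)"
    "length (filter N y) = length (filter N x)" by blast
  have "x = y" using chain_align[OF assms(1), of x g y s] x y assms by simp
  then show ?thesis using x y by blast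
qed

text \<open>Both words share the prefix up to their last counted symbol, and the second clause of
  \<open>chain\<close> makes the remainders equal.\<close>

lemma chain_inj:
  assumes "chain N M" "\<rho>1 \<in> M" "\<rho>2 \<in> M" "length (filter N \<rho>1) = length (filter N \<rho>2)"
  shows "\<rho>1 = \<rho>2"
proof -
  obtain r g t where r: "\<rho>1 = r @ g" "\<rho>2 = r @ t" "filter N g = []"
    using chain_prefix[OF assms(1-3)] assms(4) by auto
  then have "filter N t = []" using assms(4) by simp
  then show ?thesis using assms(1)[unfolded chain_def, THEN conjunct2] r assms(2,3) by blast
qed

text \<open>\<open>f\<close> occurs in the power only where a copy starts, so whole copies precede
  each occurrence.\<close>

lemma append_Cons_eq_power:
  assumes "A @ f # Y = concat (replicate m (f # V))" "f \<notin> set V"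
  shows "\<exists>k. A = concat (replicate k (f # V))"
  using assms(1)
proof (induction m arbitrary: A)
  case (Suc m)
  show ?case
  proof (cases A)
    case Nil
    then show ?thesis by (intro exI[of _ 0]) simp
  next
    case (Cons c A')
    with Suc.prems have c: "c = f" and eq: "A' @ f # Y = V @ concat (replicate m (f # V))" by auto
    from eq have "V @ concat (replicate m (f # V)) = A' @ f # Y" by simp
    then obtain A'' where A: "A' = V @ A''" "concat (replicate m (f # V)) = A'' @ f # Y"
      using assms(2) by (elim append_split) auto
    from Suc.IH[OF A(2)[symmetric]] obtain k where "A'' = concat (replicate k (f # V))" by blast
    then show ?thesis using Cons c A by (intro exI[of _ "Suc k"]) simp
  qed
qed simp

text \<open>Both are the longest prefix without a letter from \<open>B\<close>.\<close>

lemma takeWhile_split: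
  assumes "A @ f # Y = A' @ f' # Y'" "set A \<inter> B = {}" "set A' \<inter> B = {}" "f \<in> B" "f' \<in> B"
  shows "A = A'"
proof -
  have "takeWhile (\<lambda>d. d \<notin> B) (A @ f # Y) = A" using assms by (subst takeWhile_append2) auto
  moreover have "takeWhile (\<lambda>d. d \<notin> B) (A' @ f' # Y') = A'" using assms by (subst takeWhile_append2) auto
  ultimately show ?thesis using assms(1) by simp
qed

lemma filter_ConsE:
  assumes "filter N s \<noteq> []"
  obtains g d s' where "s = g @ d # s'" "filter N g = []" "N d"
proof -
  from assms obtain d l where "filter N s = d # l" by (cases "filter N s") auto
  from filter_eq_ConsD[OF this] show ?thesis using that by (auto simp: filter_empty_conv)
qed

text \<open>By \<open>chain_inj\<close> a word is determined by its number of counted symbols. Hence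
  it suffices to show that its counted symbols are those of \<open>p\<close> followed by a power of
  those of \<open>v\<close>; the remaining words end within \<open>p\<close>, up to ignored
  symbols.\<close>

lemma chain_structure:
  assumes lin: "linear_rexp e" and M: "M = rexp_lang e" and ch: "chain N M" and inf: "infinite M"
  shows "\<exists>\<beta>\<in>repeats e. \<exists>v\<in>rexp_lang \<beta>. \<exists>p s. filter N s = [] \<and>
    (\<forall>m\<ge>1. p @ concat (replicate m v) @ s \<in> M) \<and>
    (\<forall>\<rho>\<in>M. (\<exists>m\<ge>1. \<rho> = p @ concat (replicate m v) @ s) \<or>
       (\<exists>r g t. \<rho> = r @ g \<and> p = r @ t \<and> filter N g = []))"
proof -
  have "inj_on (filter N) M" using chain_inj[OF ch] by (auto intro!: inj_onI)
  then have "infinite (filter N ` M)" using inf finite_imageD by blast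
  \<comment> \<open>Only finitely many words over the atoms of \<open>e\<close> have distinct
    letters, so some filtered word repeats a letter.\<close>
  moreover have "finite {xs. set xs \<subseteq> set_rexp e \<and> distinct xs}"
    by (rule finite_subset_distinct[OF finite_set_rexp])
  ultimately obtain \<rho>0 where \<rho>0: "\<rho>0 \<in> M" "\<not> (set (filter N \<rho>0) \<subseteq> set_rexp e \<and> distinct (filter N \<rho>0))"
    by (metis (mono_tags, lifting) finite_subset image_subsetI mem_Collect_eq)
  then have "\<not> distinct (filter N \<rho>0)" using set_rexp_lang[of \<rho>0 e] M by auto
  from linear_repeat_context[OF lin \<rho>0(1)[unfolded M] this] obtain \<beta> P S where
    ctx: "repeat_context N e \<beta> P S" by blast
  from ctx[unfolded repeat_context_def, folded M] have
    b: "\<beta> \<in> repeats e" "P \<noteq> {}" "S \<noteq> {}" "\<exists>v\<in>rexp_lang \<beta>. filter N v \<noteq> []"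
      "\<forall>w\<in>P \<union> S. set w \<inter> set_rexp \<beta> = {}"
      "conc P (conc (iter (rexp_lang \<beta>)) S) \<subseteq> M"
      "\<And>w. w \<in> M \<Longrightarrow> set w \<inter> set_rexp \<beta> \<noteq> {} \<Longrightarrow> w \<in> conc P (conc (iter (rexp_lang \<beta>)) S)"
    by blast+
  obtain p0 s0 where ps: "p0 \<in> P" "s0 \<in> S" using b by blast
  define Q where "Q = (\<lambda>v. v \<in> rexp_lang \<beta> \<and> filter N v \<noteq> [])"
  \<comment> \<open>\<open>v\<close> has the fewest counted symbols among the words of \<beta> that
    have any.\<close>
  obtain v where v: "v \<in> rexp_lang \<beta>" "filter N v \<noteq> []"
    and vmin: "\<And>w. w \<in> rexp_lang \<beta> \<Longrightarrow> filter N w \<noteq> [] \<Longrightarrow> length (filter N v) \<le> length (filter N w)"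
    using b(4) arg_min_nat_lemma[of Q _ "\<lambda>v. length (filter N v)"] unfolding Q_def by blast
  obtain g0 f v' where f: "v = g0 @ f # v'" "filter N g0 = []" "N f" using v(2) by (rule filter_ConsE)
  define V where "V = filter N v'"
  have fv: "filter N v = f # V" using f V_def by simp
  have f\<beta>: "f \<in> set_rexp \<beta>" using set_rexp_lang[OF v(1)] f by auto
  \<comment> \<open>By locality, a second occurrence of \<open>f\<close> would allow cutting out a factor of \<open>v\<close>.\<close>
  have fV: "f \<notin> set V"
  proof
    assume "f \<in> set V"
    then obtain y z where "v' = y @ f # z" unfolding V_def by (meson filter_is_subset in_set_conv_decomp subsetD)
    then have "g0 @ f # z \<in> rexp_lang \<beta>"
      using linear_exchange[OF repeats_linear[OF lin b(1)], of g0 f v' "g0 @ f # y" z] v f by simp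
    from vmin[OF this] f \<open>v' = y @ f # z\<close> show False by simp
  qed
  have memM: "p @ concat ws @ s \<in> M" if "p \<in> P" "s \<in> S" "ws \<noteq> []" "set ws \<subseteq> rexp_lang \<beta>" for p s ws
    using b(6) that by (auto intro!: concI iterI)
  \<comment> \<open>A copy of \<open>v\<close> may follow \<open>ws\<close>, so a counted symbol in
    \<open>s\<close> would compete with \<open>f\<close> and equal it, although \<open>s\<close>
    avoids the atoms of \<beta>.\<close>
  have sN: "filter N s = []" if "p \<in> P" "s \<in> S" "ws \<noteq> []" "set ws \<subseteq> rexp_lang \<beta>" for p s ws
  proof (rule ccontr)
    assume "filter N s \<noteq> []"
    then obtain g d s' where s: "s = g @ d # s'" "filter N g = []" "N d" by (rule filter_ConsE)
    have "(p @ concat ws) @ g @ d # s' \<in> M" using memM[OF that] s by simp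
    moreover have "(p @ concat ws) @ g0 @ f # v' @ s \<in> M"
      using memM[OF that(1,2), of "ws @ [v]"] that v f by simp
    ultimately have "d = f" using ch s f unfolding chain_def by blast
    moreover have "set s \<inter> set_rexp \<beta> = {}" using b(5) that(2) by blast
    ultimately show False using s f\<beta> by auto
  qed
  have s0N: "filter N s0 = []" using sN[OF ps, of "[v]"] v by simp
  have pow: "p0 @ concat (replicate m v) @ s0 \<in> M" if "m \<ge> 1" for m
    using memM[OF ps, of "replicate m v"] that v by auto
  have filt: "filter N (concat (replicate m v)) = concat (replicate m (f # V))" for m
    by (induction m) (auto simp: fv)
  \<comment> \<open>Compare with \<open>p0 @ v @ s0\<close>: a common prefix ending in a counted
    symbol beyond \<open>p0\<close> would have too many counted symbols.\<close>
  have small: "\<exists>r g t. \<rho> = r @ g \<and> p0 = r @ t \<and> filter N g = []"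
    if "\<rho> \<in> M" "length (filter N \<rho>) \<le> length (filter N p0)" for \<rho>
  proof -
    have "p0 @ v @ s0 \<in> M" using pow[of 1] by simp
    from chain_prefix[OF ch that(1) this] that(2) obtain r g t where r: "\<rho> = r @ g" "p0 @ v @ s0 = r @ t"
      "r = [] \<or> N (last r)" "filter N g = []" by auto
    from r(2) obtain z where "p0 = r @ z \<or> p0 @ z = r" unfolding append_eq_append_conv2 by blast
    then consider t' where "p0 = r @ t'" | y where "r = p0 @ y" "y \<noteq> []"
      by (metis append_Nil2)
    then show ?thesis
    proof cases
      case 1 then show ?thesis using r by blast
    next
      case 2
      then have "N (last y)" using r by auto
      with 2 have "length (filter N r) > length (filter N p0)"
        using last_in_set[OF 2(2)] by (auto simp: filter_empty_conv)
      then show ?thesis using that r by simp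
    qed
  qed
  have main: "(\<exists>m\<ge>1. \<rho> = p0 @ concat (replicate m v) @ s0) \<or>
      (\<exists>r g t. \<rho> = r @ g \<and> p0 = r @ t \<and> filter N g = [])" if \<rho>: "\<rho> \<in> M" for \<rho>
  proof (cases "set \<rho> \<inter> set_rexp \<beta> = {}")
    case True
    have "length (filter N \<rho>) \<le> length (filter N p0)"
    proof (rule ccontr)
      assume "\<not> ?thesis"
      \<comment> \<open>With more counted symbols than \<open>p0\<close>, the word would by
        alignment begin with \<open>p0 @ g0 @ [f]\<close> and so contain \<open>f\<close>.\<close>
      then have len: "length (filter N (p0 @ g0 @ [f])) \<le> length (filter N \<rho>)" using f by simp
      then obtain l where "length (filter N \<rho>) = length (filter N (p0 @ g0 @ [f])) + l"
        using le_iff_add by blast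
      from filter_split[OF this] obtain x s where x: "\<rho> = x @ s" "x = [] \<or> N (last x)"
        "length (filter N x) = length (filter N (p0 @ g0 @ [f]))" by blast
      have "x = p0 @ g0 @ [f]"
        using chain_align[OF ch _ x(2), of s "p0 @ g0 @ [f]" "v' @ s0"] x \<rho> f pow[of 1] by simp
      then show False using x True f\<beta> by auto
    qed
    then show ?thesis using small[OF \<rho>] by blast
  next
    case False
    from b(7)[OF \<rho> False] obtain p ws s where d: "\<rho> = p @ concat ws @ s" "p \<in> P" "s \<in> S"
      "ws \<noteq> []" "set ws \<subseteq> rexp_lang \<beta>"
      by (elim concE iterE) blast
    \<comment> \<open>\<open>ws\<close> can be followed by \<open>f\<close>, which occurs in a power of \<open>v\<close> only at the start of a copy.\<close>
    define F where "F = filter N p @ filter N (concat ws) @ f # V"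
    have \<rho>v: "p @ concat (ws @ [v]) @ s \<in> M" using memM[OF d(2,3), of "ws @ [v]"] d v by simp
    have FF: "filter N (p @ concat (ws @ [v]) @ s) = F"
      using sN[OF d(2-)] F_def fv by simp
    \<comment> \<open>Each copy of \<open>v\<close> has the counted symbol \<open>f\<close>, so
      \<open>m\<close> copies are at least as long as \<open>F\<close>; the form \<open>Suc\<close>
      lets a first copy be split off below.\<close>
    define m where "m = Suc (length F)"
    have "length (concat (replicate m (f # V))) \<ge> m" for m by (induction m) auto
    then have "length F \<le> length (filter N (p0 @ concat (replicate m v) @ s0))"
      unfolding filter_append filt m_def by (metis Suc_leD length_append trans_le_add1 trans_le_add2)
    from chain_prefix[OF ch \<rho>v pow, of m, unfolded FF, OF _ this] m_def
    obtain r g t where r: "p @ concat (ws @ [v]) @ s = r @ g"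
      "p0 @ concat (replicate m v) @ s0 = r @ t" "filter N g = []" by auto
    have "F = filter N r" using arg_cong[OF r(1), of "filter N"] r(3) unfolding FF by simp
    then have "filter N p0 @ concat (replicate m (f # V)) = F @ filter N t"
      using arg_cong[OF r(2), of "filter N"] s0N by (simp add: filt)
    then have eq: "filter N p @ (filter N (concat ws) @ f # V @ filter N t)
      = filter N p0 @ concat (replicate m (f # V))" unfolding F_def by simp
    \<comment> \<open>Both sides avoid the atoms of \<beta>, and in \<open>eq\<close> each is
      followed by such an atom.\<close>
    have "filter N p = filter N p0"
    proof -
      obtain c Y where c: "filter N (concat ws) @ f # V @ filter N t = c # Y" "c \<in> set_rexp \<beta>"
      proof (cases "filter N (concat ws)")
        case Nil then show ?thesis using that f\<beta> by simp
      next
        case (Cons c l)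
        then have "c \<in> set (concat ws)" by (metis filter_is_subset list.set_intros(1) subsetD)
        then have "c \<in> set_rexp \<beta>" using d(5) set_rexp_lang by fastforce
        then show ?thesis using that Cons by simp
      qed
      have "set p \<inter> set_rexp \<beta> = {}" "set p0 \<inter> set_rexp \<beta> = {}" using b(5) d(2) ps(1) by blast+
      then have disj: "set (filter N p) \<inter> set_rexp \<beta> = {}" "set (filter N p0) \<inter> set_rexp \<beta> = {}"
        by auto
      from eq have "filter N p @ c # Y = filter N p0 @ f # V @ concat (replicate (length F) (f # V))"
        unfolding c(1) m_def by simp
      from takeWhile_split[OF this disj c(2) f\<beta>] show ?thesis .
    qed
    with eq have "filter N (concat ws) @ f # (V @ filter N t) = concat (replicate m (f # V))" by simp
    from append_Cons_eq_power[OF this fV] obtain k where k: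
      "filter N (concat ws) = concat (replicate k (f # V))" by blast
    have len: "filter N \<rho> = filter N p0 @ concat (replicate k (f # V))"
      using d k sN[OF d(2-)] \<open>filter N p = filter N p0\<close> by simp
    \<comment> \<open>If \<open>ws\<close> has no counted symbol, the word has as many as
      \<open>p0\<close>; otherwise it has as many as a pumped word and equals it.\<close>
    show ?thesis
    proof (cases k)
      case 0
      then show ?thesis using small[OF \<rho>] len by simp
    next
      case (Suc k')
      then have "\<rho> = p0 @ concat (replicate k v) @ s0"
        using chain_inj[OF ch \<rho> pow, of k] len s0N by (simp add: filt del: replicate.simps)
      then show ?thesis using Suc by auto
    qed
  qed
  show ?thesis using b(1) v(1) s0N pow main by blast
qed

section \<open>Dereferencing iterated words\<close>

lemma deref_from_append: "deref_from p (s @ t) = deref_from p s @ deref_from (p @ s) t"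
proof (induction s arbitrary: p)
  case (Cons c s)
  then show ?case by (cases c) simp_all
qed simp

lemma deref_from_brackets: "set g \<subseteq> range Open \<union> range Close \<Longrightarrow> deref_from p g = []"
proof (induction g arbitrary: p)
  case (Cons c g)
  then show ?case by (cases c) auto
qed simp

lemma deref_from_Term: "deref_from p (map Term w) = w"
  by (induction w arbitrary: p) auto

text \<open>Only \<open>Bind\<close> produces a closing bracket, and it puts the opening one
  first.\<close>

lemma ref_lang_Close:
  "w \<in> ref_lang \<alpha> \<Longrightarrow> w = p @ Close x # t \<Longrightarrow> Open x \<in> set p"
proof (induction \<alpha> arbitrary: w p t)
  case (Cat \<alpha> \<beta>)
  from Cat.prems(1) obtain u v where uv: "w = u @ v" "u \<in> ref_lang \<alpha>" "v \<in> ref_lang \<beta>"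
    by (auto elim!: concE)
  with Cat.prems(2) have "u @ v = p @ Close x # t" by simp
  then show ?case using Cat.IH uv by (elim append_split) auto
next
  case (Iter \<alpha>)
  then obtain ws where ws: "concat ws = p @ Close x # t" "set ws \<subseteq> ref_lang \<alpha>"
    by (auto elim!: iterE)
  from concat_split[OF ws(1)] ws(2) Iter.IH show ?case by fastforce
next
  case (Bind y \<alpha>)
  then obtain u where u: "u \<in> ref_lang \<alpha>" "(Open y # u) @ [Close y] = p @ Close x # t"
    by (auto elim!: concE)
  from u(2) show ?case
  proof (rule append_split)
    fix q assume "Open y # u = p @ Close x # q"
    then show ?thesis using Bind.IH[OF u(1)] by (auto simp: Cons_eq_append_conv)
  qed (auto simp: Cons_eq_append_conv)
qed (auto simp: Cons_eq_append_conv append_eq_Cons_conv)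

text \<open>This is the word inserted in the \<open>Var\<close> equation of
  \<open>deref_from\<close>.\<close>

definition lookup :: "'v \<Rightarrow> ('a, 'v) refword \<Rightarrow> 'a list" where
  "lookup x p = (case nearest x p of None \<Rightarrow> [] | Some (q, v) \<Rightarrow> deref_from (q @ [Open x]) v)"

text \<open>The nearest factor ends at the last closing bracket for \<open>x\<close>, which cannot
  lie in \<open>t\<close>.\<close>

lemma nearest_factor_append:
  assumes "Close x \<notin> set t"
  shows "nearest_factor x (p @ t) q v \<longleftrightarrow> nearest_factor x p q v"
proof
  assume "nearest_factor x (p @ t) q v"
  then obtain s where s: "p @ t = (q @ Open x # v) @ Close x # s" "Open x \<notin> set v"
    "Close x \<notin> set v" "Close x \<notin> set s" unfolding nearest_factor_def by auto
  from s(1) obtain s' where "p = (q @ Open x # v) @ Close x # s'" "s = s' @ t"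
    using assms by (elim append_split) auto
  then show "nearest_factor x p q v" using s unfolding nearest_factor_def by auto
qed (use assms in \<open>auto simp: nearest_factor_def\<close>)

lemma lookup_append:
  assumes "Close x \<notin> set t"
  shows "lookup x (p @ t) = lookup x p"
  unfolding lookup_def nearest_def nearest_factor_append[OF assms] by simp

text \<open>By \<open>bal\<close> the nearest factor, if there is one, lies entirely in
  \<open>z\<close>; a later reference to \<open>x\<close> thus repeats a part of what
  \<open>z\<close> has contributed.\<close>

lemma lookup_factor:
  assumes "Close x \<in> set z" and bal: "\<And>p t. z = p @ Close x # t \<Longrightarrow> Open x \<in> set p"
  shows "\<exists>A B. deref_from pre z = A @ lookup x (pre @ z) @ B"
proof (cases "nearest x (pre @ z)")
  case None
  then have "deref_from pre z = [] @ lookup x (pre @ z) @ deref_from pre z" by (simp add: lookup_def)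
  then show ?thesis by blast
next
  case (Some qv)
  obtain q v where "qv = (q, v)" by (cases qv)
  with Some have l: "lookup x (pre @ z) = deref_from (q @ [Open x]) v"
    and nf: "nearest_factor x (pre @ z) q v"
    by (simp_all add: lookup_def flip: nearest_eq_Some_iff)
  from nf obtain t where t: "pre @ z = (q @ Open x # v) @ Close x # t" "Open x \<notin> set v"
    "Close x \<notin> set t" unfolding nearest_factor_def by auto
  \<comment> \<open>The last closing bracket in \<open>z\<close> and the last opening bracket before
    it delimit the nearest factor.\<close>
  obtain z1 z2 where z: "z = z1 @ Close x # z2" "Close x \<notin> set z2"
    using split_list_last[OF assms(1)] by blast
  obtain z3 z4 where z': "z1 = z3 @ Open x # z4" "Open x \<notin> set z4"
    using split_list_last[OF bal[OF z(1)]] by blast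
  have "pre @ z1 = q @ Open x # v"
    using append_Cons_eq_last[of "pre @ z1" "Close x" z2 "q @ Open x # v" t] t z by simp
  moreover from this have "pre @ z3 = q"
    using append_Cons_eq_last[of "pre @ z3" "Open x" z4 q v] t z' by simp
  ultimately have "z = z3 @ [Open x] @ v @ [Close x] @ z2" "q = pre @ z3" using z z' by auto
  then have "deref_from pre z = deref_from pre z3 @ lookup x (pre @ z) @
      deref_from (pre @ z3 @ [Open x] @ v) ([Close x] @ z2)"
    unfolding l by (simp add: deref_from_append)
  then show ?thesis by blast
qed

lemma concat_replicate_Suc: "concat (replicate (Suc n) w) = concat (replicate n w) @ w"
  by (induction n) auto

text \<open>A reference in the current copy of \<open>w\<close> to a variable bound in \<open>w\<close> repeats a part of what
  the current or the previous copy contributes. As the contributions are short and consecutive ones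
  differ, such a reference yields \<open>[]\<close>; all other references have constant values.\<close>

lemma iterated_contribution:
  fixes u w :: "('a, 'v) refword"
  defines "E \<equiv> \<lambda>n. deref_from (u @ concat (replicate n w)) w"
  assumes bal: "\<And>p x t. w = p @ Close x # t \<Longrightarrow> Open x \<in> set p"
    and len: "\<And>n. length (E n) \<le> 1"
    and neq: "\<And>n. E (Suc n) = E n \<Longrightarrow> E n = []"
  shows "E (Suc n) = []"
proof -
  \<comment> \<open>\<open>h\<close> is what a symbol contributes in every copy but the first:
    variables bound in \<open>w\<close> give nothing, the others keep their value after
    \<open>u\<close>.\<close>
  define h where "h = (\<lambda>c. case c of Term a \<Rightarrow> [a]
    | Var x \<Rightarrow> (if Close x \<in> set w then [] else lookup x u) | _ \<Rightarrow> [])"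
  have const: "E (Suc n) = concat (map h w)" for n
  proof -
    \<comment> \<open>With index \<open>Suc n\<close> a full copy of \<open>w\<close> precedes, from
      which references to variables bound in \<open>w\<close> can draw.\<close>
    define pre where "pre = u @ concat (replicate (Suc n) w)"
    have pre: "pre = (u @ concat (replicate n w)) @ w"
      unfolding pre_def concat_replicate_Suc by simp
    have val: "lookup x (pre @ w1) = h (Var x)" if w: "w = w1 @ Var x # w2" for w1 w2 x
    proof (cases "Close x \<in> set w")
      case False
      then have "Close x \<notin> set (concat (replicate (Suc n) w) @ w1)"
        using w by (auto simp del: replicate.simps)
      from lookup_append[OF this, of u] False show ?thesis by (simp add: pre_def h_def)
    next
      case True
      have E: "E (Suc n) = deref_from pre w1 @ lookup x (pre @ w1) @ deref_from (pre @ w1 @ [Var x]) w2"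
        unfolding E_def pre_def[symmetric] using w
        by (simp add: deref_from_append lookup_def)
      have "lookup x (pre @ w1) = []"
      proof (rule ccontr)
        assume ne: "lookup x (pre @ w1) \<noteq> []"
        \<comment> \<open>A contribution has at most one letter, so a nonempty value is all of
          it.\<close>
        with E len[of "Suc n"] have nil: "deref_from pre w1 = []" and E': "E (Suc n) = lookup x (pre @ w1)"
          by (auto simp: neq_Nil_conv)
        show False
        proof (cases "Close x \<in> set w1")
          case True
          \<comment> \<open>The value would already occur in the contribution of \<open>w1\<close>,
            which is empty.\<close>
          have "\<exists>A B. deref_from pre w1 = A @ lookup x (pre @ w1) @ B"
            by (rule lookup_factor[OF True]) (use bal w in auto)
          then show False using nil ne by simp
        next
          case False
          \<comment> \<open>Here the value comes from the preceding copy and is all of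
            \<open>E n\<close>, so \<open>E n\<close> and \<open>E (Suc n)\<close> agree.\<close>
          from lookup_append[OF this] have l: "lookup x (pre @ w1) = lookup x pre" .
          have "\<exists>A B. deref_from (u @ concat (replicate n w)) w = A @ lookup x pre @ B"
            unfolding pre by (rule lookup_factor[OF \<open>Close x \<in> set w\<close>]) (use bal in auto)
          then obtain A B where "E n = A @ lookup x pre @ B" unfolding E_def by blast
          with len[of n] ne l have "E n = lookup x pre" by (auto simp: neq_Nil_conv)
          then show False using neq[of n] E' l ne by simp
        qed
      qed
      then show ?thesis using True by (simp add: h_def)
    qed
    have "deref_from (pre @ w1) w2 = concat (map h w2)" if "w = w1 @ w2" for w1 w2
      using that
    proof (induction w2 arbitrary: w1)
      case (Cons c w2)
      then have IH: "deref_from (pre @ w1 @ [c]) w2 = concat (map h w2)"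
        using Cons.IH[of "w1 @ [c]"] by simp
      show ?case
      proof (cases c)
        case (Var x)
        then show ?thesis using IH val[of w1 x w2] Cons.prems by (simp add: lookup_def)
      qed (use IH in \<open>simp_all add: h_def\<close>)
    qed simp
    from this[of "[]" w] show ?thesis unfolding E_def pre_def[symmetric] by simp
  qed
  show ?thesis using neq[of "Suc n"] const[of n] const[of "Suc n"] by simp
qed

section \<open>The language of alternating words\<close>

text \<open>Given by positions, since the proof compares letters at equal and at adjacent
  positions.\<close>

definition alternating :: "'a \<Rightarrow> 'a \<Rightarrow> nat \<Rightarrow> 'a list" where
  "alternating a b i = map (\<lambda>j. if even j then a else b) [0..<i]"

lemma alternating_even: "alternating a b (2 * k) = concat (replicate k [a, b])"
proof (induction k)
  case (Suc k)
  then show ?case unfolding concat_replicate_Suc by (simp add: alternating_def)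
qed (simp add: alternating_def)

lemma alternating_odd: "alternating a b (2 * k + 1) = concat (replicate k [a, b]) @ [a]"
  unfolding alternating_even[symmetric] by (simp add: alternating_def)

lemma frac_pow_alternating: "frac_pow [a, b] (1 / 2 * of_nat i) = alternating a b i"
proof -
  obtain k where "i = 2 * k \<or> i = 2 * k + 1" by (metis oddE evenE)
  then show ?thesis
  proof
    assume i: "i = 2 * k"
    then show ?thesis using frac_pow_eq[of "[a, b]" 0 k] alternating_even[of a b k] by simp
  next
    assume i: "i = 2 * k + 1"
    have "(1 / 2 * of_nat i :: rat) = of_nat k + of_nat 1 / of_nat (length [a, b])"
      using i by (simp add: field_simps)
    moreover have "frac_pow [a, b] \<dots> = alternating a b i"
      unfolding i alternating_odd by (subst frac_pow_eq) auto
    ultimately show ?thesis by (simp only:)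
  qed
qed

section \<open>The language of the given regular expression\<close>

lemma iter_singleton: "iter {w} = {concat (replicate k w) | k. k \<ge> 1}"
proof (intro equalityI subsetI)
  fix z assume "z \<in> iter {w}"
  then obtain ws where ws: "z = concat ws" "ws \<noteq> []" "set ws \<subseteq> {w}" by (rule iterE)
  have "ws = replicate (length ws) w" using ws(3) by (intro replicate_eqI) auto
  then have "z = concat (replicate (length ws) w)" using ws(1) by simp
  moreover have "length ws \<ge> 1" using ws(2) by (simp add: Suc_le_eq)
  ultimately show "z \<in> {concat (replicate k w) | k. k \<ge> 1}" by blast
next
  fix z assume "z \<in> {concat (replicate k w) | k. k \<ge> 1}"
  then obtain k where "z = concat (replicate k w)" "k \<ge> 1" by blast
  then show "z \<in> iter {w}" using iterI[of "replicate k w" "{w}"] by auto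
qed

text \<open>Without variables, dereferencing only strips \<open>Term\<close>; the optional last
  letter accounts for the odd lengths.\<close>

lemma lang_alternating:
  "lang (Cat (Star (Cat (Sym a) (Sym b))) (Alt (Sym a) Eps) :: ('a, 'v) regex) = range (alternating a b)"
proof -
  have T: "concat (replicate k [Term a, Term b]) = (map Term (concat (replicate k [a, b])) :: ('a, 'v) refword)" for k
    by (induction k) auto
  have "insert [] {concat (replicate k w) | k. k \<ge> 1} = range (\<lambda>k. concat (replicate k w))" for w :: "('a, 'v) refword"
  proof (intro equalityI subsetI)
    fix z assume "z \<in> insert [] {concat (replicate k w) | k. k \<ge> 1}"
    then have "z = concat (replicate 0 w) \<or> (\<exists>k. z = concat (replicate k w))" by auto
    then show "z \<in> range (\<lambda>k. concat (replicate k w))" by blast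
  next
    fix z assume "z \<in> range (\<lambda>k. concat (replicate k w))"
    then obtain k where "z = concat (replicate k w)" by blast
    then show "z \<in> insert [] {concat (replicate k w) | k. k \<ge> 1}" by (cases k) fastforce+
  qed
  then have "ref_lang (Cat (Star (Cat (Sym a) (Sym b))) (Alt (Sym a) Eps) :: ('a, 'v) regex) =
    conc (range (\<lambda>k. map Term (concat (replicate k [a, b])))) {[], [Term a]}"
    by (simp add: conc_def[of "{_}" "{_}"] iter_singleton flip: T)
  also have "\<dots> = map Term ` range (alternating a b)"
  proof (intro equalityI subsetI)
    fix w :: "('a, 'v) refword"
    assume "w \<in> conc (range (\<lambda>k. map Term (concat (replicate k [a, b])))) {[], [Term a]}"
    then obtain k where "w = map Term (concat (replicate k [a, b])) @ [Term a] \<or>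
      w = map Term (concat (replicate k [a, b]))" by (auto elim!: concE)
    then have "w = map Term (alternating a b (2 * k + 1)) \<or> w = map Term (alternating a b (2 * k))"
      unfolding alternating_even alternating_odd by simp
    then show "w \<in> map Term ` range (alternating a b)" by blast
  next
    fix w :: "('a, 'v) refword"
    assume "w \<in> map Term ` range (alternating a b)"
    then obtain i where i: "w = map Term (alternating a b i)" by blast
    obtain k where "i = 2 * k \<or> i = 2 * k + 1" by (metis oddE evenE)
    then have "w = map Term (concat (replicate k [a, b])) @ [] \<or>
      w = map Term (concat (replicate k [a, b])) @ [Term a]"
      using i by (elim disjE)
        (simp_all only: alternating_even alternating_odd map_append list.map append_Nil2 simp_thms)
    then show "w \<in> conc (range (\<lambda>k. map Term (concat (replicate k [a, b])))) {[], [Term a]}"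
      by (elim disjE) (auto intro!: concI simp del: append_Nil2)
  qed
  finally show ?thesis
    unfolding lang_def by (simp add: image_image deref_def deref_from_Term)
qed

text \<open>Hypothesis \<open>nth\<close> says that the words of the language form a prefix chain.
  Two competing terminals then stand at the same position and carry the same letter, so condition
  (1) identifies them; (2) covers variables, (3) and (4) the brackets.\<close>

lemma deterministic_chain:
  fixes \<alpha> :: "('a, 'v) regex"
  assumes "\<not> nondeterministic \<alpha>"
    and nth: "\<And>w w' i. w \<in> lang \<alpha> \<Longrightarrow> w' \<in> lang \<alpha> \<Longrightarrow> i < length w \<Longrightarrow> i < length w' \<Longrightarrow> w ! i = w' ! i"
  shows "chain (\<lambda>c. c \<notin> marked_brackets) (marked_lang \<alpha>)"
proof -
  have br: "filter (\<lambda>c. c \<notin> marked_brackets) g = [] \<longleftrightarrow> g \<in> lists marked_brackets"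
    for g :: "(('a, 'v) rsym \<times> nat) list"
    by (auto simp: filter_empty_conv)
  have brd: "deref_from p (map fst g) = []" if "g \<in> lists marked_brackets"
    for p and g :: "(('a, 'v) rsym \<times> nat) list"
    using that by (intro deref_from_brackets) (auto simp: marked_brackets_def)
  have langI: "deref (map fst \<rho>) \<in> lang \<alpha>" if "\<rho> \<in> marked_lang \<alpha>" for \<rho>
    using that rexp_lang_mark[of 0 "ref_rexp \<alpha>"]
    unfolding lang_def marked_lang_def rexp_lang_ref_rexp by blast
  have cases: "fst c \<in> range Term \<union> range Var" if "c \<notin> marked_brackets" for c :: "('a, 'v) rsym \<times> nat"
    using that by (cases c; cases "fst c") (auto simp: marked_brackets_def)
  have 4: "g1 = g2" if "r @ g1 \<in> marked_lang \<alpha>" "r @ g2 \<in> marked_lang \<alpha>"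
    "g1 \<in> lists marked_brackets" "g2 \<in> lists marked_brackets" for r g1 g2
    using assms(1) that unfolding nondeterministic_def by blast
  have 3: "g1 = g2" if "r @ g1 @ [c] @ s1 \<in> marked_lang \<alpha>" "r @ g2 @ [c] @ s2 \<in> marked_lang \<alpha>"
    "g1 \<in> lists marked_brackets" "g2 \<in> lists marked_brackets" "c \<notin> marked_brackets" for r g1 g2 c s1 s2
    using assms(1) that cases[OF that(5)] unfolding nondeterministic_def by (metis prod.collapse)
  have 2: False if "r @ g1 @ [(Var x, i)] @ s1 \<in> marked_lang \<alpha>" "r @ g2 @ [(c, j)] @ s2 \<in> marked_lang \<alpha>"
    "g1 \<in> lists marked_brackets" "g2 \<in> lists marked_brackets" "c \<in> range Term \<union> range Var" "i \<noteq> j"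
    for r g1 g2 c s1 s2 x i j
  proof -
    have "nondeterministic \<alpha>"
      unfolding nondeterministic_def
      by (rule bexI[OF _ that(1)], rule bexI[OF _ that(2)], rule exI[of _ r], rule exI[of _ s1],
          rule exI[of _ s2], rule bexI[OF _ that(3)], rule bexI[OF _ that(4)], rule disjI2, rule disjI1,
          intro exI[of _ x] exI[of _ c] exI[of _ i] exI[of _ j] conjI refl that(5,6))
    then show False using assms(1) by blast
  qed
  have 1: False if "r @ g1 @ [(Term t, i)] @ s1 \<in> marked_lang \<alpha>" "r @ g2 @ [(Term t, j)] @ s2 \<in> marked_lang \<alpha>"
    "g1 \<in> lists marked_brackets" "g2 \<in> lists marked_brackets" "i \<noteq> j"
    for r g1 g2 s1 s2 t i j
  proof -
    have "nondeterministic \<alpha>"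
      unfolding nondeterministic_def
      by (rule bexI[OF _ that(1)], rule bexI[OF _ that(2)], rule exI[of _ r], rule exI[of _ s1],
          rule exI[of _ s2], rule bexI[OF _ that(3)], rule bexI[OF _ that(4)], rule disjI1,
          intro exI[of _ t] exI[of _ i] exI[of _ j] conjI refl that(5))
    then show False using assms(1) by blast
  qed
  have main: "c = d" if h: "r @ g1 @ [c] @ s1 \<in> marked_lang \<alpha>" "r @ g2 @ [d] @ s2 \<in> marked_lang \<alpha>"
    "g1 \<in> lists marked_brackets" "g2 \<in> lists marked_brackets" "c \<notin> marked_brackets" "d \<notin> marked_brackets"
    for r g1 g2 c d s1 s2
  proof (rule ccontr)
    assume "c \<noteq> d"
    obtain c' i d' j where cd: "c = (c', i)" "d = (d', j)" by (cases c; cases d)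
    have "c \<in> set_rexp (mark 0 (ref_rexp \<alpha>))" "d \<in> set_rexp (mark 0 (ref_rexp \<alpha>))"
      using h(1,2) set_rexp_lang unfolding marked_lang_def by fastforce+
    then have ij: "i \<noteq> j" 
      using \<open>c \<noteq> d\<close> inj_onD[OF inj_on_mark[of 0 "ref_rexp \<alpha>"], of c d] cd by auto
    have c': "c' \<in> range Term \<union> range Var" and d': "d' \<in> range Term \<union> range Var"
      using cases h(5,6) cd by fastforce+
    show False
    proof (cases "c' \<in> range Var \<or> d' \<in> range Var")
      case True
      \<comment> \<open>Condition (2) is not symmetric: if only \<open>d'\<close> is a variable, the
        words change roles.\<close>
      then show False using 2 h c' d' ij cd by blast
    next
      case False
      then obtain s t where st: "c' = Term s" "d' = Term t" using c' d' by blast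
      \<comment> \<open>Brackets contribute nothing, so both letters directly follow the dereference
        of \<open>r\<close>.\<close>
      have "deref (map fst (r @ g1 @ [c] @ s1)) ! length (deref (map fst r)) = s"
        using brd[OF h(3)] cd st by (simp add: deref_def deref_from_append)
      moreover have "deref (map fst (r @ g2 @ [d] @ s2)) ! length (deref (map fst r)) = t"
        using brd[OF h(4)] cd st by (simp add: deref_def deref_from_append)
      moreover have "length (deref (map fst r)) < length (deref (map fst (r @ g1 @ [c] @ s1)))"
        using cd st by (simp add: deref_def deref_from_append)
      moreover have "length (deref (map fst r)) < length (deref (map fst (r @ g2 @ [d] @ s2)))"
        using cd st by (simp add: deref_def deref_from_append)
      ultimately have "s = t" using nth[OF langI[OF h(1)] langI[OF h(2)]] by simp
      then show False using 1 h ij cd st by blast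
    qed
  qed
  show ?thesis unfolding chain_def br using main 3 4 by (metis append_Cons append_Nil)
qed

text \<open>The pumped words would have to attain every length beyond that of the prefix, yet they
  stop growing after the first copy.\<close>

lemma lang_deterministic_neq_alternating:
  fixes \<alpha> :: "('a, 'v) regex"
  assumes det: "\<not> nondeterministic \<alpha>" and "a \<noteq> b"
  shows "lang \<alpha> \<noteq> range (alternating a b)"
proof
  assume L: "lang \<alpha> = range (alternating a b)"
  let ?N = "\<lambda>c :: ('a, 'v) rsym \<times> nat. c \<notin> marked_brackets"
  have nth: "w ! i = (if even i then a else b)" if "w \<in> lang \<alpha>" "i < length w" for w i
    using that unfolding L by (auto simp: alternating_def)
  have langM: "lang \<alpha> = (\<lambda>\<rho>. deref (map fst \<rho>)) ` marked_lang \<alpha>"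
    unfolding lang_def marked_lang_def rexp_lang_ref_rexp[symmetric]
    by (subst rexp_lang_mark[of 0, symmetric]) (simp add: image_image)
  have lenL: "\<exists>\<rho>\<in>marked_lang \<alpha>. length (deref (map fst \<rho>)) = n" for n
  proof -
    have "alternating a b n \<in> lang \<alpha>" using L by blast
    then show ?thesis unfolding langM by (auto simp: alternating_def) (metis length_map length_upt minus_nat.diff_0)
  qed
  have inf: "infinite (marked_lang \<alpha>)"
  proof
    assume "finite (marked_lang \<alpha>)"
    then have "finite ((\<lambda>\<rho>. length (deref (map fst \<rho>))) ` marked_lang \<alpha>)" by simp
    moreover have "(\<lambda>\<rho>. length (deref (map fst \<rho>))) ` marked_lang \<alpha> = UNIV" using lenL by (auto simp: image_iff) metis
    ultimately show False by simp
  qed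
  have ch: "chain ?N (marked_lang \<alpha>)" by (rule deterministic_chain[OF det]) (simp add: nth)
  from chain_structure[OF linear_mark marked_lang_def ch inf] obtain \<beta> v p s where
    bv: "\<beta> \<in> repeats (mark 0 (ref_rexp \<alpha>))" "v \<in> rexp_lang \<beta>" "filter ?N s = []"
    and pow: "\<And>m. m \<ge> 1 \<Longrightarrow> p @ concat (replicate m v) @ s \<in> marked_lang \<alpha>"
    and all: "\<And>\<rho>. \<rho> \<in> marked_lang \<alpha> \<Longrightarrow> (\<exists>m\<ge>1. \<rho> = p @ concat (replicate m v) @ s) \<or>
       (\<exists>r g t. \<rho> = r @ g \<and> p = r @ t \<and> filter ?N g = [])" by blast
  define u w where "u = map fst p" and "w = map fst v"
  obtain \<alpha>' k where "\<beta> = mark k (ref_rexp \<alpha>')" using repeats_mark_ref_rexp[OF bv(1)] by blast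
  then have w: "w \<in> ref_lang \<alpha>'"
    using bv(2) rexp_lang_mark[of k "ref_rexp \<alpha>'"] unfolding w_def rexp_lang_ref_rexp by blast
  have brd: "deref_from q (map fst g) = []" if "filter ?N g = []" for q g
    using that by (intro deref_from_brackets) (auto simp: marked_brackets_def filter_empty_conv)
  \<comment> \<open>\<open>D n\<close> is the word after \<open>n\<close> copies, and
    \<open>E n\<close> is what copy \<open>n\<close>, counted from 0, adds.\<close>
  define D where "D = (\<lambda>n. deref (u @ concat (replicate n w)))"
  define E where "E = (\<lambda>n. deref_from (u @ concat (replicate n w)) w)"
  have DE: "D (Suc n) = D n @ E n" for n
    unfolding D_def E_def concat_replicate_Suc deref_def
    by (simp add: deref_from_append[of "[]" "u @ concat (replicate n w)" w, simplified])
  have mf: "map fst (concat (replicate m v)) = concat (replicate m w)" for m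
    by (simp add: map_concat w_def)
  have Dp: "deref (map fst (p @ concat (replicate m v) @ s)) = D m" for m
    using brd[OF bv(3)] by (simp add: D_def u_def mf deref_def deref_from_append)
  \<comment> \<open>Zero copies are excluded, as \<open>p @ s\<close> need not be a marked word of
    \<alpha>.\<close>
  have DL: "D m \<in> lang \<alpha>" if "m \<ge> 1" for m
    using pow[OF that] Dp[of m] unfolding langM by (metis imageI)
  have mono: "length (D m) \<le> length (D n)" if "m \<le> n" for m n
    by (rule lift_Suc_mono_le[of "\<lambda>n. length (D n)", OF _ that]) (simp add: DE)
  \<comment> \<open>Words ending within \<open>p\<close> are too short, so these lengths come from
    pumped words.\<close>
  have attained: "\<exists>m. length (D m) = n" if "n > length (D 0)" for n
  proof -
    obtain \<rho> where \<rho>: "\<rho> \<in> marked_lang \<alpha>" "length (deref (map fst \<rho>)) = n" using lenL by blast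
    from all[OF \<rho>(1)] show ?thesis
    proof (elim disjE exE conjE)
      fix m assume "\<rho> = p @ concat (replicate m v) @ s"
      then show ?thesis using Dp[of m] \<rho> by auto
    next
      fix r g t assume r: "\<rho> = r @ g" "p = r @ t" "filter ?N g = []"
      have "deref (map fst \<rho>) = deref (map fst r)"
        using r brd[OF r(3)] by (simp add: deref_def deref_from_append)
      moreover have "length (D 0) \<ge> length (deref (map fst r))"
        using r by (simp add: D_def u_def deref_def deref_from_append)
      ultimately show ?thesis using \<rho> that by simp
    qed
  qed
  \<comment> \<open>If copy \<open>n\<close> added two letters or more, the length
    \<open>Suc (length (D n))\<close> would be skipped.\<close>
  have len: "length (E n) \<le> 1" for n
  proof -
    obtain m where m: "length (D m) = Suc (length (D n))"
      using attained[of "Suc (length (D n))"] mono[of 0 n] by auto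
    then have "m \<ge> Suc n" using mono[of m n] by (cases "m \<le> n") auto
    from mono[OF this] m show ?thesis by (simp add: DE)
  qed
  have neq: "E n = []" if eq: "E (Suc n) = E n" for n
  proof (rule ccontr)
    assume "E n \<noteq> []"
    with len[of n] obtain c where c: "E n = [c]" by (cases "E n") auto
    have D2: "D (Suc (Suc n)) = D n @ [c, c]" using c eq by (simp add: DE)
    have "D (Suc (Suc n)) \<in> lang \<alpha>" using DL by simp
    \<comment> \<open>Adjacent positions have different parity, so the letter \<open>c\<close>
      cannot stand at both.\<close>
    from nth[OF this, of "length (D n)"] nth[OF this, of "Suc (length (D n))"] D2 \<open>a \<noteq> b\<close>
    show False by (auto simp: nth_append split: if_splits)
  qed
  have E0: "E (Suc n) = []" for n
    unfolding E_def
  proof (rule iterated_contribution)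
    show "Open x \<in> set p" if "w = p @ Close x # t" for p x t using ref_lang_Close[OF w that] .
  qed (fact len[unfolded E_def], fact neq[unfolded E_def])
  have bound: "length (D m) \<le> length (D 1)" for m
  proof (induction m)
    case (Suc m) then show ?case by (cases m) (simp_all add: DE E0)
  qed (use mono[of 0 1] in simp)
  obtain m where "length (D m) = Suc (length (D 1))"
    using attained[of "Suc (length (D 1))"] mono[of 0 1] by auto
  then show False using bound[of m] by simp
qed

theorem lemma5:
  fixes a b :: "'a :: finite" and L :: "'a list set"
  assumes "infinite (UNIV :: 'v set)"
    and "a \<noteq> b"
    and "L = lang (Cat (Star (Cat (Sym a) (Sym b))) (Alt (Sym a) Eps) :: ('a, 'v) regex)"
  shows "L = {frac_pow [a, b] (1 / 2 * of_nat i) | i :: nat. True} \<and>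
         L \<in> lang ` (REG :: ('a, 'v) regex set) - lang ` (DRX :: ('a, 'v) regex set)"
proof -
  have L: "L = range (alternating a b)" using assms(3) by (simp only: lang_alternating)
  have "(Cat (Star (Cat (Sym a) (Sym b))) (Alt (Sym a) Eps) :: ('a, 'v) regex) \<in> REG"
    by (simp add: REG_def RX_def)
  then have "L \<in> lang ` (REG :: ('a, 'v) regex set)" using assms(3) by blast
  moreover have "L \<notin> lang ` (DRX :: ('a, 'v) regex set)"
    using lang_deterministic_neq_alternating[OF _ assms(2)] unfolding L DRX_def by blast
  ultimately show ?thesis unfolding frac_pow_alternating using L by blast
qed

end
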